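(* Let $\mathcal{L}\subset\mathbb{P}^2_{\mathbb{C}}$ be a supersolvable arrangement of $d\geq 6$ lines with $m(\mathcal{L})=4$. Then $d \in \{6,7,8,9,10\}$.
   Context: We work over $\mathbb{C}$. A line arrangement $\mathcal{L}\subset\mathbb{P}^2$ is a finite set of distinct lines. For $r\ge 2$, $n_r$ denotes the number of points of $\mathbb{P}^2$ lying on exactly $r$ lines of $\mathcal{L}$, and the maximal multiplicity is $m(\mathcal{L})=\max\{r: n_r\neq 0\}$. An intersection point of $\mathcal{L}$ is a point lying on at least two lines of $\mathcal{L}$. An intersection point $p$ is modular if for every other intersection point $q$ of $\mathcal{L}$ the line joining $p$ and $q$ belongs to $\mathcal{L}$. The arrangement $\mathcal{L}$ is supersolvable if it admits a modular intersection point. *)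

theory Defs
  imports "HOL-Analysis.Analysis"
begin

text \<open>
  The complex projective plane: its points are the one-dimensional and its lines the
  two-dimensional complex linear subspaces of \<open>complex ^ 3\<close>, and incidence is inclusion.
  The prefix \<open>vec\<close> refers to the vector space structure over the scalar field, with
  scaling \<open>*s\<close>; the unqualified \<open>subspace\<close>, \<open>dim\<close> and \<open>span\<close> would be taken over the reals.
\<close>

definition proj_points :: "(complex ^ 3) set set" where
  "proj_points = {p. vec.subspace p \<and> vec.dim p = 1}"

definition proj_lines :: "(complex ^ 3) set set" where
  "proj_lines = {l. vec.subspace l \<and> vec.dim l = 2}"

text \<open>This is a projective line whenever \<open>p\<close> and \<open>q\<close> are distinct projective points.\<close>

definition joining_line :: "(complex ^ 3) set \<Rightarrow> (complex ^ 3) set \<Rightarrow> (complex ^ 3) set" where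
  "joining_line p q = vec.span (p \<union> q)"

definition line_arrangement :: "(complex ^ 3) set set \<Rightarrow> bool" where
  "line_arrangement L \<longleftrightarrow> finite L \<and> L \<subseteq> proj_lines"

definition mult :: "(complex ^ 3) set set \<Rightarrow> (complex ^ 3) set \<Rightarrow> nat" where
  "mult L p = card {l \<in> L. p \<subseteq> l}"

definition n_points :: "(complex ^ 3) set set \<Rightarrow> nat \<Rightarrow> nat" where
  "n_points L r = card {p \<in> proj_points. mult L p = r}"

text \<open>
  For an arrangement of at least two lines the set below is finite and nonempty.
  The numbers \<open>n_points L r\<close> are meaningful only for \<open>r \<ge> 2\<close>, where they count a finite set.
\<close>

definition max_mult :: "(complex ^ 3) set set \<Rightarrow> nat" where
  "max_mult L = Max {r. r \<ge> 2 \<and> n_points L r \<noteq> 0}"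

definition intersection_points :: "(complex ^ 3) set set \<Rightarrow> (complex ^ 3) set set" where
  "intersection_points L = {p \<in> proj_points. mult L p \<ge> 2}"

definition modular_point :: "(complex ^ 3) set set \<Rightarrow> (complex ^ 3) set \<Rightarrow> bool" where
  "modular_point L p \<longleftrightarrow>
     p \<in> intersection_points L \<and>
     (\<forall>q \<in> intersection_points L. q \<noteq> p \<longrightarrow> joining_line p q \<in> L)"

definition supersolvable :: "(complex ^ 3) set set \<Rightarrow> bool" where
  "supersolvable L \<longleftrightarrow> (\<exists>p. modular_point L p)"

end

theory Submission
  imports Defs
begin

text \<open>
  Fix a modular point \<open>p\<close>, spanned by \<open>v\<close>. Let \<open>K\<close> be the set of the \<open>k \<le> 4\<close> lines of the
  arrangement through \<open>p\<close> and \<open>M\<close> the set of the \<open>n = d - k\<close> remaining lines. The claim is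
  \<open>n \<le> 6\<close>.

  A line \<open>h\<close> off \<open>p\<close> meets each \<open>l \<in> K\<close> in one point other than \<open>p\<close>; once a vector
  \<open>w l \<in> l\<close> outside \<open>p\<close> is chosen, that point has a coordinate \<open>f l h\<close>, an element of \<open>\<complex>\<close>.
  Modularity of \<open>p\<close> says that any two lines of \<open>M\<close> meet on a line of \<open>K\<close>, so two distinct
  members of \<open>M\<close> share the coordinate on exactly one \<open>l \<in> K\<close>. A fibre of \<open>f l\<close> consists of
  the lines of \<open>M\<close> through one point of \<open>l\<close>, so the bound on multiplicities leaves room for
  at most three of them. In the dual picture, \<open>M\<close> is a set of points of an affine plane that
  span at most four directions, with at most three points on each line in these directions.

  The decisive observation (\<open>triples_agree\<close>) is that \<open>f l\<close> has at most one fibre with three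
  elements. If \<open>A\<close> and \<open>B\<close> were two of them, the nine pairs in \<open>A \<times> B\<close> would have to agree on
  the other lines of \<open>K\<close>, of which there are at most three; each of these can serve at most
  three pairs, and then matches \<open>A\<close> with \<open>B\<close> bijectively. Hence \<open>f l'\<close> has the same sum over
  \<open>A\<close> as over \<open>B\<close> for two different lines \<open>l'\<close>. The coordinates on three concurrent lines are
  affinely dependent, so the same holds for \<open>f l\<close>, which is constant on \<open>A\<close> and on \<open>B\<close>: as
  \<open>3 \<noteq> 0\<close>, the two constants agree.

  Counting finishes the proof (\<open>card_le_six\<close>). At most three lines of \<open>M\<close> have two partners
  in their fibre of \<open>f l\<close> and the others have at most one, so \<open>l\<close> accounts for at most \<open>n + 3\<close>
  of the \<open>n (n - 1)\<close> ordered pairs. Thus \<open>n (n - 1) \<le> 4 (n + 3)\<close>, which forces \<open>n \<le> 6\<close> and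
  \<open>d \<le> 10\<close>.
\<close>

section \<open>Points in an affine plane with few directions\<close>

text \<open>
  The elements of \<open>M\<close> play the role of points of an affine plane and those of \<open>K\<close> the role of
  directions: \<open>f l\<close> is an affine function whose level sets are the lines of direction \<open>l\<close>.
  The axiom \<open>dep\<close> expresses that affine functions with different directions form, together
  with the constant \<open>1\<close>, a basis of the affine functions on the plane.
\<close>

locale few_directions =
  fixes M :: "'h set" and K :: "'k set" and f :: "'k \<Rightarrow> 'h \<Rightarrow> 'c::field_char_0"
  assumes fin_M: "finite M" and fin_K: "finite K" and card_K: "card K \<le> 4"
    and joined: "\<And>h h'. h \<in> M \<Longrightarrow> h' \<in> M \<Longrightarrow> h \<noteq> h' \<Longrightarrow> \<exists>l\<in>K. f l h = f l h'"
    and separated: "\<And>l l' h h'. l \<in> K \<Longrightarrow> l' \<in> K \<Longrightarrow> l \<noteq> l' \<Longrightarrow> h \<in> M \<Longrightarrow> h' \<in> M \<Longrightarrow>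
      f l h = f l h' \<Longrightarrow> f l' h = f l' h' \<Longrightarrow> h = h'"
    and dep: "\<And>l0 l1 l2. l0 \<in> K \<Longrightarrow> l1 \<in> K \<Longrightarrow> l2 \<in> K \<Longrightarrow> l1 \<noteq> l2 \<Longrightarrow>
      \<exists>x y z. \<forall>h\<in>M. f l0 h = x * f l1 h + y * f l2 h + z"
    and fibre_le_3: "\<And>l c. l \<in> K \<Longrightarrow> card {h \<in> M. f l h = c} \<le> 3"
begin

text \<open>
  Two distinct elements already sharing the value of \<open>f l0\<close> cannot share that of \<open>f l\<close>, so agreement under
  \<open>f l\<close> is a partial matching between \<open>A\<close> and \<open>B\<close>. A complete one pairs equal summands.
\<close>

lemma sum_eq_of_matching:
  assumes l: "l \<in> K" "l0 \<in> K" "l \<noteq> l0"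
    and AB: "A \<subseteq> M" "B \<subseteq> M" "card A = 3" "card B = 3"
    and A: "\<And>h. h \<in> A \<Longrightarrow> f l0 h = a" and B: "\<And>h. h \<in> B \<Longrightarrow> f l0 h = b"
  defines "P \<equiv> {(x, y) \<in> A \<times> B. f l x = f l y}"
  shows "card P \<le> 3" and "card P = 3 \<Longrightarrow> sum (f l) A = sum (f l) B"
proof -
  have fin: "finite A" "finite B"
    using AB fin_M finite_subset by blast+
  have "x = x'" if "(x, y) \<in> P" "(x', y) \<in> P" for x x' y
    using that AB A unfolding P_def by (intro separated[OF l]) auto
  then have inj2: "inj_on snd P"
    by (auto simp: inj_on_def)
  have "y = y'" if "(x, y) \<in> P" "(x, y') \<in> P" for x y y'
    using that AB B unfolding P_def by (intro separated[OF l]) auto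
  then have inj1: "inj_on fst P"
    by (auto simp: inj_on_def)
  have sub: "fst ` P \<subseteq> A" "snd ` P \<subseteq> B"
    by (auto simp: P_def)
  show "card P \<le> 3"
    using card_inj_on_le[OF inj1 sub(1) fin(1)] AB by simp
  assume "card P = 3"
  then have img: "fst ` P = A" "snd ` P = B"
    using sub fin AB inj1 inj2 by (simp_all add: card_image card_subset_eq)
  have "sum (f l) A = (\<Sum>q\<in>P. f l (fst q))"
    using sum.reindex[OF inj1, of "f l"] img by simp
  also have "\<dots> = (\<Sum>q\<in>P. f l (snd q))"
    by (rule sum.cong) (auto simp: P_def)
  also have "\<dots> = sum (f l) B"
    using sum.reindex[OF inj2, of "f l"] img by simp
  finally show "sum (f l) A = sum (f l) B" .
qed

text \<open>
  Equal sums over two triples give \<open>3 * a = 3 * b\<close>, which is where the characteristic matters: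
  over the field with three elements, the nine points of the affine plane span four directions
  only, and each direction has three parallel lines with three points.
\<close>

lemma triples_agree:
  assumes l0: "l0 \<in> K"
    and AB: "A \<subseteq> M" "B \<subseteq> M" "card A = 3" "card B = 3"
    and A: "\<And>h. h \<in> A \<Longrightarrow> f l0 h = a" and B: "\<And>h. h \<in> B \<Longrightarrow> f l0 h = b"
  shows "a = b"
proof (rule ccontr)
  assume "a \<noteq> b"
  define P where "P l = {(x, y) \<in> A \<times> B. f l x = f l y}" for l
  define K' where "K' = K - {l0}"
  define F where "F = {l \<in> K'. card (P l) = 3}"
  have fin: "finite A" "finite B" "finite K'" "finite F"
    using AB fin_M fin_K finite_subset by (auto simp: F_def K'_def)
  have cK': "card K' \<le> 3"
    using card_K l0 fin_K by (simp add: K'_def)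
  have P3: "card (P l) \<le> 3" if "l \<in> K'" for l
    using sum_eq_of_matching(1)[of l l0 A B a b] that l0 AB A B by (auto simp: P_def K'_def)
  \<comment> \<open>Nine pairs on at most three lines, at most three pairs each: the bound is attained.\<close>
  have "A \<times> B \<subseteq> (\<Union>l\<in>K'. P l)"
  proof
    fix q assume "q \<in> A \<times> B"
    then obtain x y where q: "q = (x, y)" "x \<in> A" "y \<in> B" by auto
    then have ne: "f l0 x \<noteq> f l0 y"
      using A B \<open>a \<noteq> b\<close> by auto
    then obtain l where "l \<in> K" "f l x = f l y"
      using joined[of x y] q AB by blast
    then show "q \<in> (\<Union>l\<in>K'. P l)"
      using q ne by (auto simp: P_def K'_def)
  qed
  moreover have "finite (P l)" for l
    using fin by (auto simp: P_def intro: finite_subset[of _ "A \<times> B"])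
  ultimately have "card (A \<times> B) \<le> card (\<Union>l\<in>K'. P l)"
    using fin by (intro card_mono) auto
  also have "\<dots> \<le> (\<Sum>l\<in>K'. card (P l))"
    using fin by (intro card_UN_le) auto
  also have "\<dots> \<le> (\<Sum>l\<in>K'. 2 + of_bool (l \<in> F))"
    using P3 by (intro sum_mono) (force simp: F_def)
  also have "\<dots> = 2 * card K' + card F"
    using fin by (simp add: sum.distrib F_def Int_def del: add_2_eq_Suc)
  finally have "3 \<le> card F"
    using AB cK' by (simp add: card_cartesian_product)
  then obtain l1 l2 where l12: "l1 \<in> F" "l2 \<in> F" "l1 \<noteq> l2"
    using card_le_Suc0_iff_eq[OF fin(4)] by fastforce
  have eq: "sum (f l) A = sum (f l) B" if "l \<in> F" for l
    using sum_eq_of_matching(2)[of l l0 A B a b] that l0 AB A B by (auto simp: P_def K'_def F_def)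
  obtain x y z where xyz: "\<And>h. h \<in> M \<Longrightarrow> f l0 h = x * f l1 h + y * f l2 h + z"
    using dep[of l0 l1 l2] l0 l12 by (auto simp: F_def K'_def)
  have combine: "sum (f l0) C = x * sum (f l1) C + y * sum (f l2) C + 3 * z"
    if "C \<subseteq> M" "card C = 3" for C
  proof -
    have "sum (f l0) C = (\<Sum>h\<in>C. x * f l1 h + y * f l2 h + z)"
      using that xyz by (intro sum.cong) auto
    then show ?thesis
      using that by (simp add: sum.distrib sum_distrib_left)
  qed
  have "sum (f l0) A = sum (f l0) B"
    using combine AB eq l12 by simp
  moreover have "sum (f l0) A = 3 * a" "sum (f l0) B = 3 * b"
    using A B AB by simp_all
  ultimately show False
    using \<open>a \<noteq> b\<close> by simp
qed

lemma sum_card_fibres_le: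
  assumes l: "l \<in> K"
  shows "(\<Sum>h\<in>M. card {h' \<in> M. f l h' = f l h}) \<le> 2 * card M + 3"
proof -
  define T where "T = {h \<in> M. card {h' \<in> M. f l h' = f l h} = 3}"
  have fin: "finite T"
    using fin_M by (simp add: T_def)
  have "card T \<le> 3"
  proof (cases "T = {}")
    case False
    then obtain t where t: "t \<in> T" by auto
    have "f l h = f l t" if "h \<in> T" for h
      by (rule triples_agree[OF l, where A = "{h' \<in> M. f l h' = f l h}" and B = "{h' \<in> M. f l h' = f l t}"])
        (use that t in \<open>auto simp: T_def\<close>)
    then have "T \<subseteq> {h' \<in> M. f l h' = f l t}"
      by (auto simp: T_def)
    then have "card T \<le> card {h' \<in> M. f l h' = f l t}"
      using fin_M by (intro card_mono) auto
    then show ?thesis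
      using fibre_le_3[OF l, of "f l t"] by simp
  qed simp
  have "card {h' \<in> M. f l h' = f l h} \<le> 2 + of_bool (h \<in> T)" if "h \<in> M" for h
    using fibre_le_3[OF l, of "f l h"] that by (auto simp: T_def)
  then have "(\<Sum>h\<in>M. card {h' \<in> M. f l h' = f l h}) \<le> (\<Sum>h\<in>M. 2 + of_bool (h \<in> T))"
    by (intro sum_mono) auto
  also have "\<dots> = 2 * card M + card T"
    using fin_M by (simp add: sum.distrib T_def Int_def del: add_2_eq_Suc)
  finally show ?thesis
    using \<open>card T \<le> 3\<close> by simp
qed

lemma card_le_six: "card M \<le> 6"
proof (rule ccontr)
  assume "\<not> card M \<le> 6"
  then obtain m where m: "card M = m + 7"
    using le_Suc_ex[of 7 "card M"] by auto
  define N where "N l h = {h' \<in> M. f l h' = f l h} - {h}" for l h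
  have finN: "finite (N l h)" for l h
    using fin_M by (simp add: N_def)
  have degree: "m + 6 \<le> (\<Sum>l\<in>K. card (N l h))" if "h \<in> M" for h
  proof -
    have "M - {h} \<subseteq> (\<Union>l\<in>K. N l h)"
      using joined[OF _ that] by (auto simp: N_def)
    then have "card (M - {h}) \<le> card (\<Union>l\<in>K. N l h)"
      using fin_K finN by (intro card_mono) auto
    also have "\<dots> \<le> (\<Sum>l\<in>K. card (N l h))"
      using fin_K by (rule card_UN_le)
    finally show ?thesis
      using that fin_M m by simp
  qed
  have pairs: "(\<Sum>h\<in>M. card (N l h)) \<le> m + 10" if "l \<in> K" for l
  proof -
    have "card {h' \<in> M. f l h' = f l h} = card (N l h) + 1" if "h \<in> M" for h
      using card_Suc_Diff1[of "{h' \<in> M. f l h' = f l h}" h] fin_M that by (simp add: N_def)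
    then have "(\<Sum>h\<in>M. card {h' \<in> M. f l h' = f l h}) = (\<Sum>h\<in>M. card (N l h)) + card M"
      by (simp add: sum.distrib del: add_Suc_right One_nat_def)
    then show ?thesis
      using sum_card_fibres_le[OF that] m by simp
  qed
  \<comment> \<open>Double counting of the ordered pairs of distinct members of \<open>M\<close>.\<close>
  have "(m + 7) * (m + 6) \<le> (\<Sum>h\<in>M. \<Sum>l\<in>K. card (N l h))"
    using sum_mono[of M "\<lambda>_. m + 6", OF degree] m by simp
  also have "\<dots> = (\<Sum>l\<in>K. \<Sum>h\<in>M. card (N l h))"
    by (rule sum.swap)
  also have "\<dots> \<le> card K * (m + 10)"
    using sum_mono[of K _ "\<lambda>_. m + 10", OF pairs] by simp
  also have "\<dots> \<le> 4 * (m + 10)"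
    using card_K by (rule mult_le_mono1)
  finally show False
    by (simp add: algebra_simps)
qed

end

section \<open>Points and lines as linear subspaces\<close>

lemma proj_lineD:
  assumes "l \<in> proj_lines"
  shows "vec.subspace l" "vec.dim l = 2"
  using assms by (auto simp: proj_lines_def)

lemma proj_line_eqI:
  assumes "l \<in> proj_lines" "l' \<in> proj_lines" "l \<subseteq> l'"
  shows "l = l'"
  using assms by (intro vec.subspace_dim_equal) (auto simp: proj_lines_def)

lemma proj_point_generator:
  assumes "p \<in> proj_points"
  obtains v where "v \<noteq> 0" "p = vec.span {v}"
proof -
  have p: "vec.subspace p" "vec.dim p = 1"
    using assms by (auto simp: proj_points_def)
  then have "\<not> p \<subseteq> {0}"
    by (metis vec.dim_eq_0 zero_neq_one)
  then obtain v where v: "v \<in> p" "v \<noteq> 0" by auto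
  have "vec.span {v} = p"
    using p v by (intro vec.subspace_dim_equal vec.span_minimal) auto
  then show thesis
    using v that by blast
qed

lemma span_singleton_point: "v \<noteq> 0 \<Longrightarrow> vec.span {v} \<in> proj_points"
  by (simp add: proj_points_def)

lemma span_singleton_subset_iff:
  assumes "vec.subspace l"
  shows "vec.span {v} \<subseteq> l \<longleftrightarrow> v \<in> l"
  using assms by (meson insert_subset vec.span_minimal vec.span_base empty_subsetI insertI1 subsetD)

lemma proj_line_complement:
  assumes "h \<in> proj_lines" "v \<notin> h"
  shows "\<exists>t. w - t *s v \<in> h"
proof -
  have h: "vec.span h = h" "vec.dim h = 2"
    using proj_lineD[OF assms(1)] by simp_all
  have "vec.dim (insert v h) = 3"
    unfolding vec.dim_insert h(1) using assms(2) h(2) by simp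
  then have "vec.span (insert v h) = UNIV"
    using vec.dim_eq_full[of "insert v h"] by (simp add: vec.dimension_def card_cart_basis)
  then have "\<exists>t. w - t *s v \<in> vec.span h"
    using vec.span_breakdown_eq[of w v h] by blast
  then show ?thesis
    unfolding h(1) .
qed

lemma proj_line_span:
  assumes "l \<in> proj_lines" "v \<in> l" "v \<noteq> 0" "w \<in> l" "w \<notin> vec.span {v}"
  shows "l = vec.span {w, v}"
proof -
  have "vec.dim {w, v} = 2"
    using assms by (simp add: vec.dim_insert)
  then have "vec.span {w, v} = l"
    using assms by (intro vec.subspace_dim_equal vec.span_minimal) (auto simp: proj_lines_def)
  then show ?thesis ..
qed

lemma proj_line_not_subset_point:
  assumes "l \<in> proj_lines"
  shows "\<exists>w\<in>l. w \<notin> vec.span {v}"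
proof (rule ccontr)
  assume "\<not> ?thesis"
  then have "vec.dim l \<le> card {v}"
    by (intro vec.dim_le_card) auto
  then show False
    using assms by (simp add: proj_lines_def)
qed

lemma proj_lines_meet:
  assumes h: "h \<in> proj_lines" "h' \<in> proj_lines" "h \<noteq> h'"
  obtains u where "u \<noteq> 0" "u \<in> h" "u \<in> h'"
proof -
  obtain x where x: "x \<in> h" "x \<notin> h'"
    using proj_line_eqI[OF h(1,2)] h(3) by auto
  obtain y where y: "y \<in> h" "y \<notin> vec.span {x}"
    using proj_line_not_subset_point[OF h(1)] by blast
  obtain t where t: "y - t *s x \<in> h'"
    using proj_line_complement[OF h(2) x(2)] by blast
  have "y - t *s x \<noteq> 0"
    using y(2) by (auto simp: vec.span_singleton)
  moreover have "y - t *s x \<in> h"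
    using proj_lineD(1)[OF h(1)] x y by (intro vec.subspace_diff vec.subspace_scale)
  ultimately show thesis
    using t that by blast
qed

lemma proj_point_on_two_lines_unique:
  assumes l: "l \<in> proj_lines" "l' \<in> proj_lines" "l \<noteq> l'"
    and pq: "p \<in> proj_points" "q \<in> proj_points" "p \<subseteq> l \<inter> l'" "q \<subseteq> l \<inter> l'"
  shows "p = q"
proof (rule ccontr)
  assume "p \<noteq> q"
  obtain v where v: "v \<noteq> 0" "p = vec.span {v}"
    using proj_point_generator pq(1) by blast
  obtain w where w: "w \<noteq> 0" "q = vec.span {w}"
    using proj_point_generator pq(2) by blast
  have "w \<notin> vec.span {v}"
  proof
    assume "w \<in> vec.span {v}"
    then have "q \<subseteq> p"
      using v w by (simp add: span_singleton_subset_iff)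
    then have "q = p"
      using pq by (intro vec.subspace_dim_equal) (auto simp: proj_points_def)
    then show False
      using \<open>p \<noteq> q\<close> by simp
  qed
  moreover have "v \<in> l" "v \<in> l'" "w \<in> l" "w \<in> l'"
    using pq v w vec.span_base by blast+
  ultimately have "l = vec.span {w, v}" "l' = vec.span {w, v}"
    using proj_line_span l v by blast+
  then show False
    using l(3) by simp
qed

lemma finite_intersection_points:
  assumes "line_arrangement L"
  shows "finite (intersection_points L)"
proof -
  have L: "finite L" "L \<subseteq> proj_lines"
    using assms by (auto simp: line_arrangement_def)
  have "\<exists>l l'. l \<in> L \<and> l' \<in> L \<and> l \<noteq> l' \<and> p \<subseteq> l \<inter> l'" if "p \<in> intersection_points L" for p
  proof -
    have "\<not> card {l \<in> L. p \<subseteq> l} \<le> Suc 0"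
      using that by (simp add: intersection_points_def mult_def)
    moreover have "finite {l \<in> L. p \<subseteq> l}"
      using L(1) by simp
    ultimately show ?thesis
      using card_le_Suc0_iff_eq[of "{l \<in> L. p \<subseteq> l}"] by blast
  qed
  then obtain a b where ab: "\<And>p. p \<in> intersection_points L \<Longrightarrow>
      a p \<in> L \<and> b p \<in> L \<and> a p \<noteq> b p \<and> p \<subseteq> a p \<inter> b p"
    by metis
  define lines where "lines p = (a p, b p)" for p
  have "inj_on lines (intersection_points L)"
  proof (rule inj_onI)
    fix p q assume pq: "p \<in> intersection_points L" "q \<in> intersection_points L" "lines p = lines q"
    then have "a q = a p" "b q = b p"
      by (simp_all add: lines_def)
    then show "p = q"
      using ab[OF pq(1)] ab[OF pq(2)] L(2) pq(1,2)
      by (intro proj_point_on_two_lines_unique[of "a p" "b p"]) (auto simp: intersection_points_def)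
  qed
  moreover have "lines ` intersection_points L \<subseteq> L \<times> L"
    using ab by (auto simp: lines_def)
  ultimately show ?thesis
    using L(1) by (meson finite_SigmaI inj_on_finite)
qed

text \<open>
  Since \<open>card\<close> is zero on infinite sets, a multiplicity is seen by \<open>max_mult\<close> only because there
  are finitely many intersection points.
\<close>

lemma mult_le_max_mult:
  assumes L: "line_arrangement L" and p: "p \<in> intersection_points L"
  shows "mult L p \<le> max_mult L"
proof -
  have finL: "finite L"
    using L by (simp add: line_arrangement_def)
  have "{r. r \<ge> 2 \<and> n_points L r \<noteq> 0} \<subseteq> {..card L}"
  proof
    fix r assume "r \<in> {r. r \<ge> 2 \<and> n_points L r \<noteq> 0}"
    then obtain q where "mult L q = r"
      by (auto simp: n_points_def card_eq_0_iff)
    then show "r \<in> {..card L}"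
      using finL by (auto simp: mult_def intro: card_mono)
  qed
  then have fin: "finite {r. r \<ge> 2 \<and> n_points L r \<noteq> 0}"
    using finite_subset by blast
  have "{q \<in> proj_points. mult L q = mult L p} \<subseteq> intersection_points L"
    using p by (auto simp: intersection_points_def)
  then have "finite {q \<in> proj_points. mult L q = mult L p}"
    using finite_intersection_points[OF L] finite_subset by blast
  then have "n_points L (mult L p) \<noteq> 0"
    using p by (auto simp: n_points_def intersection_points_def)
  then show ?thesis
    using p fin by (auto simp: max_mult_def intersection_points_def intro: Max_ge)
qed

section \<open>Coordinates on the lines through a point\<close>

text \<open>
  The linear functional with kernel \<open>h\<close> and value \<open>1\<close> at \<open>v\<close>. If \<open>l\<close> is the span of \<open>v\<close> and \<open>w\<close>,
  then \<open>h\<close> meets \<open>l\<close> in the span of \<open>w - pencil_coord v h w *s v\<close>.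
\<close>

definition pencil_coord :: "complex ^ 3 \<Rightarrow> (complex ^ 3) set \<Rightarrow> complex ^ 3 \<Rightarrow> complex" where
  "pencil_coord v h w = (THE t. w - t *s v \<in> h)"

lemma pencil_coord_eq_iff:
  assumes h: "h \<in> proj_lines" "v \<notin> h"
  shows "pencil_coord v h w = t \<longleftrightarrow> w - t *s v \<in> h"
proof -
  have sub: "vec.subspace h"
    using h by (simp add: proj_lines_def)
  have unique: "s = t" if "w - s *s v \<in> h" "w - t *s v \<in> h" for s t
  proof (rule ccontr)
    assume "s \<noteq> t"
    have "(w - s *s v) - (w - t *s v) \<in> h"
      by (rule vec.subspace_diff[OF sub that])
    also have "(w - s *s v) - (w - t *s v) = (t - s) *s v"
      by (simp add: vec_eq_iff algebra_simps)
    finally have "inverse (t - s) *s ((t - s) *s v) \<in> h"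
      by (rule vec.subspace_scale[OF sub])
    moreover have "inverse (t - s) * (t - s) = 1"
      using \<open>s \<noteq> t\<close> by simp
    ultimately have "v \<in> h"
      by (metis vec.scale_scale vec.scale_one)
    then show False
      using h(2) by blast
  qed
  obtain r where r: "w - r *s v \<in> h"
    using proj_line_complement[OF h] by blast
  then have "pencil_coord v h w = r"
    unfolding pencil_coord_def by (rule the_equality) (rule unique[OF _ r])
  then show ?thesis
    using r unique by blast
qed

lemma pencil_coord_linear:
  assumes h: "h \<in> proj_lines" "v \<notin> h"
  shows "pencil_coord v h (a *s x + b *s y + c *s v)
    = a * pencil_coord v h x + b * pencil_coord v h y + c"
proof -
  have sub: "vec.subspace h"
    using h by (simp add: proj_lines_def)
  define s t where "s = pencil_coord v h x" and "t = pencil_coord v h y"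
  have "x - s *s v \<in> h" "y - t *s v \<in> h"
    using pencil_coord_eq_iff[OF h] s_def t_def by blast+
  then have "a *s (x - s *s v) + b *s (y - t *s v) \<in> h"
    using sub by (intro vec.subspace_add vec.subspace_scale)
  also have "a *s (x - s *s v) + b *s (y - t *s v)
      = (a *s x + b *s y + c *s v) - (a * s + b * t + c) *s v"
    by (simp add: vec_eq_iff algebra_simps)
  finally show ?thesis
    using pencil_coord_eq_iff[OF h] s_def t_def by blast
qed

lemma pencil_coord_eq_0_iff:
  assumes "h \<in> proj_lines" "v \<notin> h"
  shows "pencil_coord v h w = 0 \<longleftrightarrow> w \<in> h"
  using pencil_coord_eq_iff[OF assms, of w 0] by simp

lemma span_pair_obtain:
  assumes "x \<in> vec.span {w, v}"
  obtains a c where "x = a *s w + c *s v"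
proof -
  obtain a where "x - a *s w \<in> vec.span {v}"
    using assms vec.span_breakdown_eq by blast
  then obtain c where "x - a *s w = c *s v"
    by (auto simp: vec.span_singleton)
  then show thesis
    using that[of a c] by (simp add: algebra_simps)
qed

text \<open>
  Two distinct lines through \<open>v\<close> span the whole space, so every \<open>x\<close> is a combination of \<open>v\<close>
  and the two chosen vectors \<open>w\<close>, \<open>w'\<close>.
\<close>

lemma pencil_coord_dependent:
  assumes l: "l \<in> proj_lines" "l' \<in> proj_lines" "l \<noteq> l'" and v: "v \<noteq> 0" "v \<in> l" "v \<in> l'"
    and w: "w \<in> l" "w \<notin> vec.span {v}" "w' \<in> l'" "w' \<notin> vec.span {v}"
  obtains a b c where "\<And>h. h \<in> proj_lines \<Longrightarrow> v \<notin> h \<Longrightarrow>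
    pencil_coord v h x = a * pencil_coord v h w + b * pencil_coord v h w' + c"
proof -
  have span: "l = vec.span {w, v}" "l' = vec.span {w', v}"
    using proj_line_span l v w by blast+
  have "w' \<notin> l"
  proof
    assume "w' \<in> l"
    then have "l = vec.span {w', v}"
      using proj_line_span l v w by blast
    then show False
      using l(3) span(2) by simp
  qed
  then obtain b where "x - b *s w' \<in> l"
    using proj_line_complement[OF l(1)] by blast
  then obtain a c where "x - b *s w' = a *s w + c *s v"
    using span_pair_obtain span(1) by metis
  then have "x = a *s w + b *s w' + c *s v"
    by (simp add: algebra_simps)
  then show thesis
    using that pencil_coord_linear by blast
qed

section \<open>The lines of a supersolvable arrangement\<close>

text \<open>
  Modularity of \<open>p\<close> becomes the axiom \<open>joined\<close> of \<open>few_directions\<close>, and the bound on the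
  multiplicities, which also counts the line \<open>l\<close> itself, becomes \<open>fibre_le_3\<close>.
\<close>

lemma card_le_ten_of_modular_point:
  assumes L: "line_arrangement L" and mod: "modular_point L p"
    and max: "\<And>q. q \<in> intersection_points L \<Longrightarrow> mult L q \<le> 4"
  shows "card L \<le> 10"
proof -
  have finL: "finite L" and linesL: "L \<subseteq> proj_lines"
    using L by (auto simp: line_arrangement_def)
  have p: "p \<in> intersection_points L"
    using mod by (simp add: modular_point_def)
  then obtain v where v: "v \<noteq> 0" "p = vec.span {v}"
    using proj_point_generator by (auto simp: intersection_points_def)
  define K where "K = {l \<in> L. v \<in> l}"
  define M where "M = {h \<in> L. v \<notin> h}"
  have through: "vec.span {u} \<subseteq> l \<longleftrightarrow> u \<in> l" if "l \<in> L" for u l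
    using that linesL proj_lineD(1) by (intro span_singleton_subset_iff) auto
  have lineK: "l \<in> proj_lines" "v \<in> l" "l \<in> L" if "l \<in> K" for l
    using that linesL by (auto simp: K_def)
  have lineM: "h \<in> proj_lines" "v \<notin> h" "h \<in> L" if "h \<in> M" for h
    using that linesL by (auto simp: M_def)
  have "{l \<in> L. p \<subseteq> l} = K"
    using through v by (auto simp: K_def)
  then have cardK: "card K \<le> 4"
    using max[OF p] by (simp add: mult_def)
  have "\<forall>l\<in>K. \<exists>w\<in>l. w \<notin> vec.span {v}"
    using proj_line_not_subset_point lineK by blast
  then obtain w where w: "\<And>l. l \<in> K \<Longrightarrow> w l \<in> l" "\<And>l. l \<in> K \<Longrightarrow> w l \<notin> vec.span {v}"
    by metis
  define f where "f l h = pencil_coord v h (w l)" for l h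
  have dep: "\<exists>a b c. \<forall>h\<in>M. pencil_coord v h x = a * f l h + b * f l' h + c"
    if l: "l \<in> K" "l' \<in> K" "l \<noteq> l'" for l l' x
    using pencil_coord_dependent[of l l' v "w l" "w l'" x] l lineK lineM v(1) w
    unfolding f_def by metis
  interpret few_directions M K f
  proof
    show "finite M" "finite K"
      using finL by (auto simp: M_def K_def)
    show "card K \<le> 4"
      by (rule cardK)
  next
    fix h h' assume h: "h \<in> M" "h' \<in> M" "h \<noteq> h'"
    obtain u where u: "u \<noteq> 0" "u \<in> h" "u \<in> h'"
      using proj_lines_meet lineM h by metis
    define q where "q = vec.span {u}"
    have "{h, h'} \<subseteq> {l \<in> L. q \<subseteq> l}"
      using through lineM(3) h u by (auto simp: q_def)
    then have "card {h, h'} \<le> mult L q"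
      unfolding mult_def using finL by (intro card_mono) auto
    then have q: "q \<in> intersection_points L"
      using h u by (simp add: intersection_points_def q_def span_singleton_point)
    have "\<not> p \<subseteq> h" "q \<subseteq> h"
      using h lineM u v through by (auto simp: q_def)
    then have "q \<noteq> p"
      by auto
    define l where "l = joining_line p q"
    have "l \<in> L"
      using mod q \<open>q \<noteq> p\<close> by (simp add: modular_point_def l_def)
    moreover have "p \<subseteq> l" "q \<subseteq> l"
      unfolding l_def joining_line_def using vec.span_superset by blast+
    ultimately have l: "l \<in> K" and "u \<in> l"
      using through v by (auto simp: K_def q_def)
    then obtain a c where ac: "u = a *s w l + c *s v"
      using proj_line_span[OF lineK(1,2)[OF l] v(1)] w[OF l] span_pair_obtain by metis
    have "a \<noteq> 0"
    proof
      assume "a = 0"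
      then have "u \<in> p"
        using ac v by (simp add: vec.span_singleton)
      then have "q \<subseteq> p"
        using v by (simp add: q_def span_singleton_subset_iff)
      then have "q = p"
        using p q by (intro vec.subspace_dim_equal) (auto simp: proj_points_def intersection_points_def)
      then show False
        using \<open>q \<noteq> p\<close> by simp
    qed
    have "a * f l k + c = 0" if "k \<in> M" "u \<in> k" for k
    proof -
      have "pencil_coord v k u = a * f l k + c"
        using pencil_coord_linear[OF lineM(1,2)[OF that(1)], of a "w l" 0 0 c]
        by (simp add: ac f_def)
      then show ?thesis
        using pencil_coord_eq_0_iff[OF lineM(1,2)[OF that(1)], of u] that(2) by simp
    qed
    then have "a * f l h + c = a * f l h' + c"
      using h u by simp
    then have "f l h = f l h'"
      using \<open>a \<noteq> 0\<close> by simp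
    then show "\<exists>l\<in>K. f l h = f l h'"
      using l by blast
  next
    fix l l' h h'
    assume l: "l \<in> K" "l' \<in> K" "l \<noteq> l'" and h: "h \<in> M" "h' \<in> M"
      and eq: "f l h = f l h'" "f l' h = f l' h'"
    \<comment> \<open>The functionals of \<open>h\<close> and \<open>h'\<close> agree on the basis \<open>v\<close>, \<open>w l\<close>, \<open>w l'\<close>, so their
      kernels are equal.\<close>
    have "pencil_coord v h x = pencil_coord v h' x" for x
    proof -
      obtain a b c where "\<forall>k\<in>M. pencil_coord v k x = a * f l k + b * f l' k + c"
        using dep[OF l] by blast
      then show ?thesis
        using h eq by simp
    qed
    then have "x \<in> h \<longleftrightarrow> x \<in> h'" for x
      using pencil_coord_eq_0_iff lineM h by metis
    then show "h = h'"
      by blast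
  next
    fix l0 l1 l2 assume "l1 \<in> K" "l2 \<in> K" "l1 \<noteq> l2"
    then show "\<exists>x y z. \<forall>h\<in>M. f l0 h = x * f l1 h + y * f l2 h + z"
      using dep[of l1 l2 "w l0"] by (simp add: f_def)
  next
    fix l c assume l: "l \<in> K"
    define u where "u = w l - c *s v"
    have sub: "vec.subspace l"
      using lineK l by (simp add: proj_lines_def)
    have "u \<noteq> 0"
      using w(2)[OF l] by (auto simp: u_def vec.span_singleton)
    have "u \<in> l"
      unfolding u_def using sub w(1)[OF l] lineK(2)[OF l]
      by (intro vec.subspace_diff vec.subspace_scale)
    define H where "H = {h \<in> M. f l h = c}"
    have finH: "finite H"
      using finL by (simp add: H_def M_def)
    have "u \<in> h" if "h \<in> H" for h
      using that pencil_coord_eq_iff[OF lineM(1,2), of h "w l" c] by (simp add: H_def f_def u_def)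
    then have "insert l H \<subseteq> {k \<in> L. vec.span {u} \<subseteq> k}"
      using through lineK(3)[OF l] lineM(3) \<open>u \<in> l\<close> by (auto simp: H_def)
    then have "card (insert l H) \<le> mult L (vec.span {u})"
      unfolding mult_def using finL by (intro card_mono) auto
    moreover have "l \<notin> H"
      using l by (auto simp: H_def M_def K_def)
    ultimately have le: "card H + 1 \<le> mult L (vec.span {u})"
      using finH by simp
    show "card {h \<in> M. f l h = c} \<le> 3"
    proof (cases "H = {}")
      case False
      then have "card H \<ge> 1"
        using finH by (simp add: Suc_le_eq card_gt_0_iff)
      then have "vec.span {u} \<in> intersection_points L"
        using le \<open>u \<noteq> 0\<close> by (simp add: intersection_points_def span_singleton_point)
      then show ?thesis
        using max[of "vec.span {u}"] le by (simp add: H_def)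
    qed (simp flip: H_def)
  qed
  have "L = K \<union> M"
    by (auto simp: K_def M_def)
  then have "card L \<le> card K + card M"
    using card_Un_le by metis
  then show ?thesis
    using cardK card_le_six by simp
qed

theorem theorem3p5:
  fixes L :: "(complex ^ 3) set set" and d :: nat
  assumes "line_arrangement L"
    and "supersolvable L"
    and "card L = d"
    and "d \<ge> 6"
    and "max_mult L = 4"
  shows "d \<in> {6, 7, 8, 9, 10}"
proof -
  obtain p where "modular_point L p"
    using assms(2) by (auto simp: supersolvable_def)
  then have "card L \<le> 10"
    using card_le_ten_of_modular_point mult_le_max_mult assms(1,5) by metis
  then show ?thesis
    using assms(3,4) by auto
qed

end
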